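(* Let $\mu\in(0,1/2]$, and consider the planar circular restricted charged three-body problem with parameters $\mu,\beta_1,\beta_2$. \begin{enumerate} \item If $(\beta_1,\beta_2)\in R'_1$, there exists exactly one collinear equilibrium solution with $x\in I_1$, exactly one with $x\in I_2$, and exactly one with $x\in I_3$. \item If $(\beta_1,\beta_2)\in R'_2$, there exists exactly one collinear equilibrium solution with $x\in I_3$. \item If $(\beta_1,\beta_2)\in R'_4$, there exists exactly one collinear equilibrium solution with $x\in I_1$. \item If $(\beta_1,\beta_2)\in R'_5$, there exists exactly one collinear equilibrium solution with $x\in I_3$. Moreover, if $\beta_2>1$, there exists exactly one collinear equilibrium solution with $x\in I_1$; and if $0<\beta_2<1$, there exists exactly one collinear equilibrium solution with $x\in I_2$. \item If $(\beta_1,\beta_2)\in R'_6$, there exists exactly one collinear equilibrium solution with $x\in I_1$. Moreover, if $\beta_1>1$, there exists exactly one collinear equilibrium solution with $x\in I_3$; and if $0<\beta_1<1$, there exists exactly one collinear equilibrium solution with $x\in I_2$. \end{enumerate}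
   Context: The collinear equilibrium solutions of the planar circular restricted charged three-body problem (parameters $\mu\in(0,1/2]$, $\beta_1,\beta_2\in\mathbb{R}$ with $(\beta_1-1)(\beta_2-1)<1$) are the points $(x,0)$, $x\in\mathbb{R}\setminus\{-\mu,1-\mu\}$, with $F(x)=0$, where $$F(x)=x-\frac{\beta_1(1-\mu)(x+\mu)}{\rho_1^3}-\frac{\beta_2\,\mu\,(x+\mu-1)}{\rho_2^3},\qquad \rho_1=|x+\mu|,\quad \rho_2=|x+\mu-1|.$$ Intervals: $I_1=(-\infty,-\mu)$, $I_2=(-\mu,1-\mu)$, $I_3=(1-\mu,\infty)$. Regions of parameters: $R'_1=\{\beta_1>0,\ \beta_2>0,\ (\beta_1-1)(\beta_2-1)<1\}$; $R'_2=\{\beta_1<0,\ \beta_2>0,\ (\beta_1-1)(\beta_2-1)<1\}=\{\beta_1<0,\ \beta_2>\frac{\beta_1}{\beta_1-1}\}$; $R'_4=\{\beta_1>0,\ \beta_2<0,\ (\beta_1-1)(\beta_2-1)<1\}$; $R'_5=\{\beta_1=0,\ \beta_2>0\}$; $R'_6=\{\beta_1>0,\ \beta_2=0\}$. *)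

theory Defs
  imports Complex_Main
begin

definition rho1 :: "real \<Rightarrow> real \<Rightarrow> real" where
  "rho1 \<mu> x = \<bar>x + \<mu>\<bar>"

definition rho2 :: "real \<Rightarrow> real \<Rightarrow> real" where
  "rho2 \<mu> x = \<bar>x + \<mu> - 1\<bar>"

definition F :: "real \<Rightarrow> real \<Rightarrow> real \<Rightarrow> real \<Rightarrow> real" where
  "F \<mu> \<beta>1 \<beta>2 x =
     x - \<beta>1 * (1 - \<mu>) * (x + \<mu>) / rho1 \<mu> x ^ 3
       - \<beta>2 * \<mu> * (x + \<mu> - 1) / rho2 \<mu> x ^ 3"

text \<open>The primaries sit at \<open>x = -\<mu>\<close> and \<open>x = 1 - \<mu>\<close>. They have to be excluded explicitly,
  because there \<open>F\<close> has a junk value coming from division by zero.\<close>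

definition collinear_equilibrium :: "real \<Rightarrow> real \<Rightarrow> real \<Rightarrow> real \<times> real \<Rightarrow> bool" where
  "collinear_equilibrium \<mu> \<beta>1 \<beta>2 p \<longleftrightarrow>
     (\<exists>x. p = (x, 0) \<and> x \<notin> {-\<mu>, 1 - \<mu>} \<and> F \<mu> \<beta>1 \<beta>2 x = 0)"

definition I1 :: "real \<Rightarrow> real set" where "I1 \<mu> = {..<-\<mu>}"

definition I2 :: "real \<Rightarrow> real set" where "I2 \<mu> = {-\<mu><..<1 - \<mu>}"

definition I3 :: "real \<Rightarrow> real set" where "I3 \<mu> = {1 - \<mu><..}"

definition unique_collinear_equilibrium_in ::
    "real \<Rightarrow> real \<Rightarrow> real \<Rightarrow> real set \<Rightarrow> bool" where
  "unique_collinear_equilibrium_in \<mu> \<beta>1 \<beta>2 I \<longleftrightarrow>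
     (\<exists>!p. collinear_equilibrium \<mu> \<beta>1 \<beta>2 p \<and> fst p \<in> I)"

definition R1' :: "(real \<times> real) set" where
  "R1' = {(\<beta>1, \<beta>2). \<beta>1 > 0 \<and> \<beta>2 > 0 \<and> (\<beta>1 - 1) * (\<beta>2 - 1) < 1}"

definition R2' :: "(real \<times> real) set" where
  "R2' = {(\<beta>1, \<beta>2). \<beta>1 < 0 \<and> \<beta>2 > 0 \<and> (\<beta>1 - 1) * (\<beta>2 - 1) < 1}"

definition R4' :: "(real \<times> real) set" where
  "R4' = {(\<beta>1, \<beta>2). \<beta>1 > 0 \<and> \<beta>2 < 0 \<and> (\<beta>1 - 1) * (\<beta>2 - 1) < 1}"

text \<open>On the positive coordinate half-axes the condition \<open>(\<beta>1 - 1) * (\<beta>2 - 1) < 1\<close> is automatic.\<close>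

definition R5' :: "(real \<times> real) set" where
  "R5' = {(\<beta>1, \<beta>2). \<beta>1 = 0 \<and> \<beta>2 > 0}"

definition R6' :: "(real \<times> real) set" where
  "R6' = {(\<beta>1, \<beta>2). \<beta>1 > 0 \<and> \<beta>2 = 0}"

lemma R2'_alt: "R2' = {(\<beta>1, \<beta>2). \<beta>1 < 0 \<and> \<beta>2 > \<beta>1 / (\<beta>1 - 1)}"
proof -
  have "(b > 0 \<and> (a - 1) * (b - 1) < 1) \<longleftrightarrow> b > a / (a - 1)" if "a < 0" for a b :: real
  proof -
    have "(a - 1) * (b - 1) < 1 \<longleftrightarrow> b > a / (a - 1)"
      using that by (simp add: divide_less_eq algebra_simps)
    moreover have "a / (a - 1) > 0"
      using that by (simp add: zero_less_divide_iff)
    ultimately show ?thesis by linarith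
  qed
  then show ?thesis by (auto simp: R2'_def)
qed

end

theory Submission
  imports Defs
begin

text \<open>The reflection \<open>x \<mapsto> -x\<close> turns the problem with parameters \<open>(\<mu>, \<beta>1, \<beta>2)\<close> into the one with
  parameters \<open>(1 - \<mu>, \<beta>2, \<beta>1)\<close>, exchanges \<open>I1\<close> and \<open>I3\<close> and preserves \<open>I2\<close>. So only \<open>I3\<close> and \<open>I2\<close>
  have to be studied, provided that \<open>\<mu>\<close> ranges over all of \<open>(0, 1)\<close>: the bound \<open>1 / 2\<close> is not
  invariant under the reflection.

  With \<open>y = x + \<mu>\<close> the distance to the first primary, \<open>F\<close> equals
  \<open>x - \<beta>1 (1 - \<mu>) / y\<^sup>2 - \<beta>2 \<mu> / (y - 1)\<^sup>2\<close> on \<open>I3\<close> and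
  \<open>x - \<beta>1 (1 - \<mu>) / y\<^sup>2 + \<beta>2 \<mu> / (1 - y)\<^sup>2\<close> on \<open>I2\<close>.

  For nonnegative charges \<open>F\<close> is strictly increasing on both intervals, being the sum of \<open>x\<close> and
  of nondecreasing terms. On \<open>I3\<close> with \<open>\<beta>1 < 0\<close> this can fail, but \<open>(y - 1)\<^sup>2 F\<close>, which has the
  same zeros, is strictly increasing because \<open>(y - 1)\<^sup>2 / y\<^sup>2 = (1 - 1 / y)\<^sup>2\<close> is increasing
  (lemma \<open>F_zero_unique_I3\<close>). Hence there is at most one equilibrium.

  A zero exists by the intermediate value theorem. Multiplying \<open>F\<close> by the squared distances to the
  primaries gives a polynomial with the same zeros, and its sign at a primary is determined by the
  charge of that primary. If a primary bounding the interval is uncharged, only the distance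
  to the other one is used as a factor; the sign at the uncharged end then compares \<open>x\<close> with the
  attraction of the other primary at unit distance, and this is where the thresholds \<open>\<beta>1 > 1\<close> and
  \<open>\<beta>2 < 1\<close> come from. At the infinite end of \<open>I3\<close> the term \<open>x\<close> dominates.\<close>

section \<open>Equilibria as zeros of \<open>F\<close>\<close>

lemma unique_collinear_equilibrium_in_iff:
  assumes "-\<mu> \<notin> I" "1 - \<mu> \<notin> I"
  shows "unique_collinear_equilibrium_in \<mu> \<beta>1 \<beta>2 I \<longleftrightarrow> (\<exists>!x. x \<in> I \<and> F \<mu> \<beta>1 \<beta>2 x = 0)"
proof -
  have "collinear_equilibrium \<mu> \<beta>1 \<beta>2 p \<and> fst p \<in> I \<longleftrightarrow>
      snd p = 0 \<and> fst p \<in> I \<and> F \<mu> \<beta>1 \<beta>2 (fst p) = 0" for p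
    using assms by (cases p) (auto simp: collinear_equilibrium_def)
  then show ?thesis
    unfolding unique_collinear_equilibrium_in_def by (simp add: Ex1_def)
qed

lemma F_reflect: "F (1 - \<mu>) \<beta>2 \<beta>1 (-x) = - F \<mu> \<beta>1 \<beta>2 x"
proof -
  have 1: "-x + (1 - \<mu>) = -(x + \<mu> - 1)" and 2: "-x + (1 - \<mu>) - 1 = -(x + \<mu>)" by simp_all
  show ?thesis unfolding F_def rho1_def rho2_def 1 2 abs_minus_cancel
    by (simp del: minus_add_distrib minus_diff_eq)
qed

lemma unique_collinear_equilibrium_in_reflect:
  assumes "-\<mu> \<notin> I" "1 - \<mu> \<notin> I"
    and "unique_collinear_equilibrium_in (1 - \<mu>) \<beta>2 \<beta>1 (uminus ` I)"
  shows "unique_collinear_equilibrium_in \<mu> \<beta>1 \<beta>2 I"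
proof -
  have mem: "-x \<in> uminus ` I \<longleftrightarrow> x \<in> I" for x by auto
  have "- (1 - \<mu>) \<notin> uminus ` I" "1 - (1 - \<mu>) \<notin> uminus ` I"
    using assms(1,2) mem[of "1 - \<mu>"] mem[of "-\<mu>"] by simp_all
  with assms(3) have "\<exists>!x. x \<in> uminus ` I \<and> F (1 - \<mu>) \<beta>2 \<beta>1 x = 0"
    by (simp only: unique_collinear_equilibrium_in_iff not_False_eq_True)
  then obtain x where
    x: "x \<in> uminus ` I" "F (1 - \<mu>) \<beta>2 \<beta>1 x = 0" and
    unique: "\<And>x'. x' \<in> uminus ` I \<Longrightarrow> F (1 - \<mu>) \<beta>2 \<beta>1 x' = 0 \<Longrightarrow> x' = x"
    by blast
  have "\<exists>!x. x \<in> I \<and> F \<mu> \<beta>1 \<beta>2 x = 0"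
  proof (rule ex1I[of _ "-x"])
    show "-x \<in> I \<and> F \<mu> \<beta>1 \<beta>2 (-x) = 0"
      using x mem[of "-x"] F_reflect[of \<mu> \<beta>2 \<beta>1 "-x"] by simp
    show "x' = -x" if "x' \<in> I \<and> F \<mu> \<beta>1 \<beta>2 x' = 0" for x'
      using that unique[of "-x'"] mem[of x'] F_reflect[of \<mu> \<beta>2 \<beta>1 x'] by simp
  qed
  then show ?thesis using assms(1,2) by (simp add: unique_collinear_equilibrium_in_iff)
qed

lemma uminus_image_I1: "uminus ` I1 \<mu> = I3 (1 - \<mu>)"
  by (simp add: I1_def I3_def)

lemma uminus_image_I2: "uminus ` I2 \<mu> = I2 (1 - \<mu>)"
  by (simp add: I2_def)

text \<open>The strict inequalities keep the zero away from the end points, where the polynomial multiple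
  of \<open>F\<close> to which this is applied loses its relation to \<open>F\<close>.\<close>

lemma interior_zero:
  fixes f :: "real \<Rightarrow> real"
  assumes "a \<le> b" "f a < 0" "0 < f b" "continuous_on {a..b} f"
  obtains x where "a < x" "x < b" "f x = 0"
proof -
  obtain x where x: "a \<le> x" "x \<le> b" "f x = 0"
    using IVT'[of f a 0 b] assms by auto
  with assms have "x \<noteq> a" "x \<noteq> b" by auto
  with x have "a < x" "x < b" by auto
  then show thesis using x(3) by (rule that)
qed

lemma inverse_square_antimono:
  fixes s t :: real
  assumes "0 < s" "s \<le> t" "0 \<le> c"
  shows "c / t^2 \<le> c / s^2"
  using assms by (intro divide_left_mono power_mono) auto

lemma clear_denominators:
  fixes s t :: real
  assumes "s \<noteq> 0" "t \<noteq> 0"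
  shows "s^2 * t^2 * (x - c / s^2 - d / t^2) = x * s^2 * t^2 - c * t^2 - d * s^2"
  using assms by (simp add: field_simps)

section \<open>Beyond the second primary\<close>

lemma F_I3:
  assumes "x \<in> I3 \<mu>"
  shows "F \<mu> \<beta>1 \<beta>2 x = x - \<beta>1 * (1 - \<mu>) / (x + \<mu>)^2 - \<beta>2 * \<mu> / (x + \<mu> - 1)^2"
proof -
  have "x + \<mu> > 0" "x + \<mu> - 1 > 0" using assms by (auto simp: I3_def)
  then show ?thesis
    by (simp add: F_def rho1_def rho2_def power3_eq_cube power2_eq_square del: diff_gt_0_iff_gt)
qed

text \<open>For \<open>\<beta>1 < 0\<close> the repulsive term decreases with the distance, so \<open>F\<close> itself need not be
  increasing. The factor \<open>(x + \<mu> - 1)\<^sup>2\<close> repairs this and at the same time turns the term of the second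
  primary into a constant.\<close>

lemma F_zero_unique_I3:
  assumes \<mu>: "0 < \<mu>" "\<mu> < 1" and "0 \<le> \<beta>2"
    and x: "x \<in> I3 \<mu>" "F \<mu> \<beta>1 \<beta>2 x = 0" and x': "x' \<in> I3 \<mu>" "F \<mu> \<beta>1 \<beta>2 x' = 0"
  shows "x = x'"
proof -
  have False
    if u: "u \<in> I3 \<mu>" "F \<mu> \<beta>1 \<beta>2 u = 0" and v: "v \<in> I3 \<mu>" "F \<mu> \<beta>1 \<beta>2 v = 0" and less: "u < v" for u v
  proof -
    have pos: "0 < u" "0 < v" "0 < u + \<mu>" "0 < v + \<mu>" "0 < u + \<mu> - 1" "0 < v + \<mu> - 1"
      using u v \<mu> by (auto simp: I3_def)
    show False
    proof (cases "0 \<le> \<beta>1")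
      case True
      have "\<beta>1 * (1 - \<mu>) / (v + \<mu>)^2 \<le> \<beta>1 * (1 - \<mu>) / (u + \<mu>)^2"
        using pos less True \<mu> by (intro inverse_square_antimono) auto
      moreover have "\<beta>2 * \<mu> / (v + \<mu> - 1)^2 \<le> \<beta>2 * \<mu> / (u + \<mu> - 1)^2"
        using pos less \<open>0 \<le> \<beta>2\<close> \<mu> by (intro inverse_square_antimono) auto
      ultimately show False using u v less by (simp add: F_I3)
    next
      case False
      define g where "g x = (x + \<mu> - 1)^2 * x + (-\<beta>1) * (1 - \<mu>) * (1 - 1 / (x + \<mu>))^2" for x
      have g: "g x = \<beta>2 * \<mu>" if x: "x \<in> I3 \<mu>" "F \<mu> \<beta>1 \<beta>2 x = 0" for x
      proof -
        have pos: "0 < x + \<mu>" "0 < x + \<mu> - 1" using x \<mu> by (auto simp: I3_def)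
        have eq: "1 - 1 / (x + \<mu>) = (x + \<mu> - 1) / (x + \<mu>)"
          using pos by (simp add: diff_divide_distrib)
        have "g x = (x + \<mu> - 1)^2 * (x - \<beta>1 * (1 - \<mu>) / (x + \<mu>)^2)"
          unfolding g_def eq power_divide by (simp add: right_diff_distrib[of "(x + \<mu> - 1)^2" x])
        also have "x - \<beta>1 * (1 - \<mu>) / (x + \<mu>)^2 = \<beta>2 * \<mu> / (x + \<mu> - 1)^2"
          using x by (simp add: F_I3)
        finally show ?thesis using pos by simp
      qed
      have "(u + \<mu> - 1)^2 * u < (v + \<mu> - 1)^2 * v"
        using pos less by (intro mult_strict_mono power_strict_mono) auto
      moreover have "(1 - 1 / (u + \<mu>))^2 \<le> (1 - 1 / (v + \<mu>))^2"
        using pos less by (intro power_mono diff_mono divide_left_mono) auto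
      then have "(-\<beta>1) * (1 - \<mu>) * (1 - 1 / (u + \<mu>))^2 \<le> (-\<beta>1) * (1 - \<mu>) * (1 - 1 / (v + \<mu>))^2"
        using False \<mu> by (intro mult_left_mono) (auto simp: mult_nonpos_nonneg)
      ultimately have "g u < g v" unfolding g_def by linarith
      then show False using g u v by simp
    qed
  qed
  from this[OF x x'] this[OF x' x] show ?thesis by (cases x x' rule: linorder_cases) auto
qed

text \<open>Both primaries are at distance at least 1 from this point, so each charge term of \<open>F\<close> is at
  most \<open>\<bar>\<beta>1\<bar>\<close> or \<open>\<bar>\<beta>2\<bar>\<close>.\<close>

lemma F_pos_far:
  assumes \<mu>: "0 < \<mu>" "\<mu> < 1"
  shows "0 < F \<mu> \<beta>1 \<beta>2 (2 + \<bar>\<beta>1\<bar> + \<bar>\<beta>2\<bar>)"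
proof -
  let ?X = "2 + \<bar>\<beta>1\<bar> + \<bar>\<beta>2\<bar>"
  have bound: "c * m / t^2 \<le> \<bar>c\<bar>" if "1 \<le> t" "0 < m" "m < 1" for c m t :: real
  proof -
    have "c * m \<le> \<bar>c\<bar> * m" using that by (intro mult_right_mono) auto
    also have "\<dots> \<le> \<bar>c\<bar> * 1" using that by (intro mult_left_mono) auto
    also have "\<dots> \<le> \<bar>c\<bar> * t^2" using that by (intro mult_left_mono one_le_power) auto
    finally show ?thesis using that by (simp add: divide_le_eq)
  qed
  have "\<beta>1 * (1 - \<mu>) / (?X + \<mu>)^2 \<le> \<bar>\<beta>1\<bar>" "\<beta>2 * \<mu> / (?X + \<mu> - 1)^2 \<le> \<bar>\<beta>2\<bar>"
    using \<mu> by (intro bound; simp)+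
  moreover have "?X \<in> I3 \<mu>" using \<mu> by (auto simp: I3_def)
  ultimately show ?thesis unfolding F_I3[OF \<open>?X \<in> I3 \<mu>\<close>] by linarith
qed

lemma unique_equilibrium_I3:
  assumes \<mu>: "0 < \<mu>" "\<mu> < 1" and \<beta>: "0 < \<beta>2 \<or> \<beta>2 = 0 \<and> 1 < \<beta>1"
  shows "unique_collinear_equilibrium_in \<mu> \<beta>1 \<beta>2 (I3 \<mu>)"
proof -
  let ?X = "2 + \<bar>\<beta>1\<bar> + \<bar>\<beta>2\<bar>"
  have X: "1 - \<mu> \<le> ?X" "?X \<in> I3 \<mu>" using \<mu> by (auto simp: I3_def)
  have pos: "0 < F \<mu> \<beta>1 \<beta>2 ?X" using \<mu> by (rule F_pos_far)
  have "\<exists>x. x \<in> I3 \<mu> \<and> F \<mu> \<beta>1 \<beta>2 x = 0"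
  proof (cases "0 < \<beta>2")
    case True
    define f where "f x = x * (x + \<mu>)^2 * (x + \<mu> - 1)^2
      - \<beta>1 * (1 - \<mu>) * (x + \<mu> - 1)^2 - \<beta>2 * \<mu> * (x + \<mu>)^2" for x
    have f: "f x = (x + \<mu>)^2 * (x + \<mu> - 1)^2 * F \<mu> \<beta>1 \<beta>2 x" if "x \<in> I3 \<mu>" for x
    proof -
      have "x + \<mu> \<noteq> 0" "x + \<mu> - 1 \<noteq> 0" using that by (auto simp: I3_def)
      then show ?thesis unfolding F_I3[OF that] f_def by (rule clear_denominators[symmetric])
    qed
    obtain x where x: "1 - \<mu> < x" "x < ?X" "f x = 0"
    proof (rule interior_zero[of "1 - \<mu>" ?X f])
      show "f (1 - \<mu>) < 0" using True \<mu> by (simp add: f_def)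
      show "0 < f ?X" using X(2) pos \<mu> unfolding f[OF X(2)] by (intro mult_pos_pos) auto
      show "continuous_on {1 - \<mu>..?X} f" unfolding f_def by (intro continuous_intros)
    qed (use X in auto)
    then have "x \<in> I3 \<mu>" by (simp add: I3_def)
    with x f[of x] show ?thesis by (auto simp: I3_def intro!: exI[of _ x])
  next
    case False
    with \<beta> have \<beta>': "\<beta>2 = 0" "1 < \<beta>1" by auto
    define f where "f x = x * (x + \<mu>)^2 - \<beta>1 * (1 - \<mu>)" for x
    have f: "f x = (x + \<mu>)^2 * F \<mu> \<beta>1 \<beta>2 x" if "x \<in> I3 \<mu>" for x
    proof -
      have "x + \<mu> \<noteq> 0" using that by (auto simp: I3_def)
      then show ?thesis
        by (simp add: F_I3[OF that] f_def \<beta>' right_diff_distrib[of "(x + \<mu>)^2" x])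
    qed
    obtain x where x: "1 - \<mu> < x" "x < ?X" "f x = 0"
    proof (rule interior_zero[of "1 - \<mu>" ?X f])
      show "f (1 - \<mu>) < 0" using \<beta>' \<mu> by (simp add: f_def)
      show "0 < f ?X" using X(2) pos \<mu> unfolding f[OF X(2)] by (intro mult_pos_pos) auto
      show "continuous_on {1 - \<mu>..?X} f" unfolding f_def by (intro continuous_intros)
    qed (use X in auto)
    then have "x \<in> I3 \<mu>" by (simp add: I3_def)
    with x f[of x] show ?thesis by (auto simp: I3_def intro!: exI[of _ x])
  qed
  moreover have "0 \<le> \<beta>2" using \<beta> by auto
  ultimately have "\<exists>!x. x \<in> I3 \<mu> \<and> F \<mu> \<beta>1 \<beta>2 x = 0"
    using F_zero_unique_I3[OF \<mu>, of \<beta>2 _ \<beta>1] by blast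
  then show ?thesis by (subst unique_collinear_equilibrium_in_iff) (auto simp: I3_def)
qed

section \<open>Between the primaries\<close>

lemma F_I2:
  assumes "x \<in> I2 \<mu>"
  shows "F \<mu> \<beta>1 \<beta>2 x = x - \<beta>1 * (1 - \<mu>) / (x + \<mu>)^2 + \<beta>2 * \<mu> / (1 - \<mu> - x)^2"
proof -
  have pos: "x + \<mu> > 0" "1 - \<mu> - x > 0" using assms by (auto simp: I2_def)
  have eq: "x + \<mu> - 1 = - (1 - \<mu> - x)" by simp
  show ?thesis
    unfolding F_def rho1_def rho2_def eq abs_minus_cancel
    using pos by (simp add: power3_eq_cube power2_eq_square del: diff_gt_0_iff_gt minus_diff_eq)
qed

lemma F_strict_mono_on_I2:
  assumes \<mu>: "0 < \<mu>" "\<mu> < 1" and "0 \<le> \<beta>1" "0 \<le> \<beta>2"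
  shows "strict_mono_on (I2 \<mu>) (F \<mu> \<beta>1 \<beta>2)"
proof (rule strict_mono_onI)
  fix u v assume uv: "u \<in> I2 \<mu>" "v \<in> I2 \<mu>" "u < v"
  then have pos: "0 < u + \<mu>" "0 < 1 - \<mu> - v" by (auto simp: I2_def)
  have "\<beta>1 * (1 - \<mu>) / (v + \<mu>)^2 \<le> \<beta>1 * (1 - \<mu>) / (u + \<mu>)^2"
    using pos uv assms by (intro inverse_square_antimono) auto
  moreover have "\<beta>2 * \<mu> / (1 - \<mu> - u)^2 \<le> \<beta>2 * \<mu> / (1 - \<mu> - v)^2"
    using pos uv assms by (intro inverse_square_antimono) auto
  ultimately show "F \<mu> \<beta>1 \<beta>2 u < F \<mu> \<beta>1 \<beta>2 v" using uv by (simp add: F_I2)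
qed

text \<open>The hypothesis covers only an uncharged first primary; an uncharged second one is the mirror
  image.\<close>

lemma unique_equilibrium_I2:
  assumes \<mu>: "0 < \<mu>" "\<mu> < 1" and \<beta>: "0 < \<beta>2" "0 < \<beta>1 \<or> \<beta>1 = 0 \<and> \<beta>2 < 1"
  shows "unique_collinear_equilibrium_in \<mu> \<beta>1 \<beta>2 (I2 \<mu>)"
proof -
  have "\<exists>x. x \<in> I2 \<mu> \<and> F \<mu> \<beta>1 \<beta>2 x = 0"
  proof (cases "0 < \<beta>1")
    case True
    define f where "f x = x * (x + \<mu>)^2 * (1 - \<mu> - x)^2
      - \<beta>1 * (1 - \<mu>) * (1 - \<mu> - x)^2 + \<beta>2 * \<mu> * (x + \<mu>)^2" for x
    obtain x where x: "-\<mu> < x" "x < 1 - \<mu>" "f x = 0"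
    proof (rule interior_zero[of "-\<mu>" "1 - \<mu>" f])
      show "f (-\<mu>) < 0" using True \<mu> by (simp add: f_def)
      show "0 < f (1 - \<mu>)" using \<beta> \<mu> by (simp add: f_def)
      show "continuous_on {-\<mu>..1 - \<mu>} f" unfolding f_def by (intro continuous_intros)
    qed auto
    have mem: "x \<in> I2 \<mu>" and nz: "x + \<mu> \<noteq> 0" "1 - \<mu> - x \<noteq> 0"
      using x by (auto simp: I2_def)
    then have "f x = (x + \<mu>)^2 * (1 - \<mu> - x)^2 * F \<mu> \<beta>1 \<beta>2 x"
      using clear_denominators[OF nz, of x "\<beta>1 * (1 - \<mu>)" "- (\<beta>2 * \<mu>)"]
      unfolding F_I2[OF mem] f_def by simp
    with x mem nz show ?thesis by (auto intro!: exI[of _ x])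
  next
    case False
    with \<beta> have \<beta>': "\<beta>1 = 0" "\<beta>2 < 1" by auto
    define f where "f x = x * (1 - \<mu> - x)^2 + \<beta>2 * \<mu>" for x
    obtain x where x: "-\<mu> < x" "x < 1 - \<mu>" "f x = 0"
    proof (rule interior_zero[of "-\<mu>" "1 - \<mu>" f])
      show "f (-\<mu>) < 0" using \<beta>' \<mu> by (simp add: f_def)
      show "0 < f (1 - \<mu>)" using \<beta> \<mu> by (simp add: f_def)
      show "continuous_on {-\<mu>..1 - \<mu>} f" unfolding f_def by (intro continuous_intros)
    qed auto
    have mem: "x \<in> I2 \<mu>" and nz: "1 - \<mu> - x \<noteq> 0"
      using x by (auto simp: I2_def)
    then have "f x = (1 - \<mu> - x)^2 * F \<mu> \<beta>1 \<beta>2 x"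
      by (simp add: F_I2 f_def \<beta>' distrib_left del: right_minus_eq)
    with x mem nz show ?thesis by (auto intro!: exI[of _ x])
  qed
  moreover have "inj_on (F \<mu> \<beta>1 \<beta>2) (I2 \<mu>)"
    using \<beta> by (intro strict_mono_on_imp_inj_on F_strict_mono_on_I2 \<mu>) auto
  then have "x = x'"
    if "x \<in> I2 \<mu>" "F \<mu> \<beta>1 \<beta>2 x = 0" "x' \<in> I2 \<mu>" "F \<mu> \<beta>1 \<beta>2 x' = 0" for x x'
    using that by (simp add: inj_on_def)
  ultimately have "\<exists>!x. x \<in> I2 \<mu> \<and> F \<mu> \<beta>1 \<beta>2 x = 0" by blast
  then show ?thesis by (subst unique_collinear_equilibrium_in_iff) (auto simp: I2_def)
qed

section \<open>Mirror images and the classification\<close>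

lemma unique_equilibrium_I1:
  assumes "0 < \<mu>" "\<mu> < 1" "0 < \<beta>1 \<or> \<beta>1 = 0 \<and> 1 < \<beta>2"
  shows "unique_collinear_equilibrium_in \<mu> \<beta>1 \<beta>2 (I1 \<mu>)"
proof (rule unique_collinear_equilibrium_in_reflect)
  show "unique_collinear_equilibrium_in (1 - \<mu>) \<beta>2 \<beta>1 (uminus ` I1 \<mu>)"
    unfolding uminus_image_I1 using assms by (intro unique_equilibrium_I3) auto
qed (auto simp: I1_def)

lemma unique_equilibrium_I2_uncharged_second:
  assumes "0 < \<mu>" "\<mu> < 1" "0 < \<beta>1" "\<beta>1 < 1"
  shows "unique_collinear_equilibrium_in \<mu> \<beta>1 0 (I2 \<mu>)"
proof (rule unique_collinear_equilibrium_in_reflect)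
  show "unique_collinear_equilibrium_in (1 - \<mu>) 0 \<beta>1 (uminus ` I2 \<mu>)"
    unfolding uminus_image_I2 using assms by (intro unique_equilibrium_I2) auto
qed (auto simp: I2_def)

theorem theorem4p3:
  fixes \<mu> \<beta>1 \<beta>2 :: real
  assumes "0 < \<mu>" and "\<mu> \<le> 1 / 2"
  shows "((\<beta>1, \<beta>2) \<in> R1' \<longrightarrow>
            unique_collinear_equilibrium_in \<mu> \<beta>1 \<beta>2 (I1 \<mu>) \<and>
            unique_collinear_equilibrium_in \<mu> \<beta>1 \<beta>2 (I2 \<mu>) \<and>
            unique_collinear_equilibrium_in \<mu> \<beta>1 \<beta>2 (I3 \<mu>)) \<and>
         ((\<beta>1, \<beta>2) \<in> R2' \<longrightarrow>
            unique_collinear_equilibrium_in \<mu> \<beta>1 \<beta>2 (I3 \<mu>)) \<and>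
         ((\<beta>1, \<beta>2) \<in> R4' \<longrightarrow>
            unique_collinear_equilibrium_in \<mu> \<beta>1 \<beta>2 (I1 \<mu>)) \<and>
         ((\<beta>1, \<beta>2) \<in> R5' \<longrightarrow>
            unique_collinear_equilibrium_in \<mu> \<beta>1 \<beta>2 (I3 \<mu>) \<and>
            (\<beta>2 > 1 \<longrightarrow> unique_collinear_equilibrium_in \<mu> \<beta>1 \<beta>2 (I1 \<mu>)) \<and>
            (0 < \<beta>2 \<and> \<beta>2 < 1 \<longrightarrow> unique_collinear_equilibrium_in \<mu> \<beta>1 \<beta>2 (I2 \<mu>))) \<and>
         ((\<beta>1, \<beta>2) \<in> R6' \<longrightarrow>
            unique_collinear_equilibrium_in \<mu> \<beta>1 \<beta>2 (I1 \<mu>) \<and>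
            (\<beta>1 > 1 \<longrightarrow> unique_collinear_equilibrium_in \<mu> \<beta>1 \<beta>2 (I3 \<mu>)) \<and>
            (0 < \<beta>1 \<and> \<beta>1 < 1 \<longrightarrow> unique_collinear_equilibrium_in \<mu> \<beta>1 \<beta>2 (I2 \<mu>)))"
proof -
  have \<mu>: "0 < \<mu>" "\<mu> < 1" using assms by auto
  show ?thesis
    unfolding R1'_def R2'_def R4'_def R5'_def R6'_def
    using unique_equilibrium_I1[OF \<mu>, of \<beta>1 \<beta>2] unique_equilibrium_I2[OF \<mu>, of \<beta>2 \<beta>1]
      unique_equilibrium_I3[OF \<mu>, of \<beta>2 \<beta>1] unique_equilibrium_I2_uncharged_second[OF \<mu>, of \<beta>1]
    by auto
qed

end
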